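(* For all positive integers $k$ and $d$, there is a graph $G$ that is the union of $d$ comparability graphs such that $\omega(G)=k$ and $\frac{|V(G)|}{\alpha(G)}=\chi_f(G)=\chi(G)=k^d$.
   Context: Graphs are finite and simple. For a graph $G$, $\omega(G)$ denotes the clique number (the maximum size of a clique in $G$), $\alpha(G)$ denotes the maximum size of an independent set in $G$, $\chi(G)$ denotes the chromatic number, and $\chi_f(G)$ denotes the fractional chromatic number, i.e. the minimum of $\sum_{I} w(I)$ over all assignments of nonnegative real weights $w(I)$ to the independent sets $I$ of $G$ such that $\sum_{I\ni v} w(I)\ge 1$ for every vertex $v$. A graph $G$ is the union of graphs $G_1,\ldots,G_d$ if $V(G)=V(G_1)\cup\cdots\cup V(G_d)$ and $E(G)=E(G_1)\cup\cdots\cup E(G_d)$. A comparability graph is a graph whose vertex set is a partially ordered set $(P,\preceq)$, where two (distinct) vertices are adjacent if and only if they are comparable in $(P,\preceq)$. *)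

theory Defs
  imports Complex_Main "HOL-Library.Ramsey"
begin

text \<open>
  A graph is given by a vertex set \<open>V\<close> and a set \<open>E\<close> of two-element edges. The predicates
  \<open>clique\<close> and \<open>indep\<close> are those of \<open>HOL-Library.Ramsey\<close>; they do not themselves confine the
  set to \<open>V\<close>, so this is added wherever they are used.
\<close>

definition simple_graph :: "'a set \<Rightarrow> 'a set set \<Rightarrow> bool" where
  "simple_graph V E \<longleftrightarrow> finite V \<and> E \<subseteq> nsets V 2"

definition clique_number :: "'a set \<Rightarrow> 'a set set \<Rightarrow> nat" where
  "clique_number V E = Max {card K | K. K \<subseteq> V \<and> clique K E}"

definition independent_sets :: "'a set \<Rightarrow> 'a set set \<Rightarrow> 'a set set" where
  "independent_sets V E = {I. I \<subseteq> V \<and> indep I E}"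

definition independence_number :: "'a set \<Rightarrow> 'a set set \<Rightarrow> nat" where
  "independence_number V E = Max (card ` independent_sets V E)"

definition proper_coloring :: "'a set \<Rightarrow> 'a set set \<Rightarrow> nat \<Rightarrow> ('a \<Rightarrow> nat) \<Rightarrow> bool" where
  "proper_coloring V E n c \<longleftrightarrow>
     c ` V \<subseteq> {..<n} \<and> (\<forall>x\<in>V. \<forall>y\<in>V. {x, y} \<in> E \<longrightarrow> c x \<noteq> c y)"

definition chromatic_number :: "'a set \<Rightarrow> 'a set set \<Rightarrow> nat" where
  "chromatic_number V E = (LEAST n. \<exists>c. proper_coloring V E n c)"

definition fractional_coloring :: "'a set \<Rightarrow> 'a set set \<Rightarrow> ('a set \<Rightarrow> real) \<Rightarrow> bool" where
  "fractional_coloring V E w \<longleftrightarrow>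
     (\<forall>I \<in> independent_sets V E. 0 \<le> w I) \<and>
     (\<forall>v\<in>V. 1 \<le> (\<Sum>I \<in> {I \<in> independent_sets V E. v \<in> I}. w I))"

text \<open>
  \<open>LEAST\<close> is taken over the reals: it denotes the minimum of the set of total weights, which is
  attained for every finite graph (linear programming), and is unspecified otherwise.
\<close>

definition fractional_chromatic_number :: "'a set \<Rightarrow> 'a set set \<Rightarrow> real" where
  "fractional_chromatic_number V E =
     (LEAST t. \<exists>w. fractional_coloring V E w \<and> t = (\<Sum>I \<in> independent_sets V E. w I))"

definition comparability_graph :: "'a set \<Rightarrow> 'a set set \<Rightarrow> bool" where
  "comparability_graph V E \<longleftrightarrow> finite V \<and>
     (\<exists>r. partial_order_on V r \<and>
          E = {{x, y} | x y. x \<in> V \<and> y \<in> V \<and> x \<noteq> y \<and> ((x, y) \<in> r \<or> (y, x) \<in> r)})"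

text \<open>The \<open>d\<close> graphs may have different vertex sets, each carrying its own order.\<close>

definition union_of_comparability_graphs :: "nat \<Rightarrow> 'a set \<Rightarrow> 'a set set \<Rightarrow> bool" where
  "union_of_comparability_graphs d V E \<longleftrightarrow>
     (\<exists>Vs Es. (\<forall>i<d. comparability_graph (Vs i) (Es i)) \<and>
              V = (\<Union>i<d. Vs i) \<and> E = (\<Union>i<d. Es i))"

end

theory Submission
  imports Defs "HOL-Analysis.Convex" "HOL-Library.FuncSet"
begin

text \<open>
  A vertex has \<open>d\<close> coordinates, each a pair of a level below \<open>k\<close> and a position on a long cycle. In the
  \<open>i\<close>-th order, comparable vertices have equal positions in all other coordinates, while in
  coordinate \<open>i\<close> the level increases and the position moves by a nonzero bounded amount, the bound
  being proportional to the level difference. Adjacent vertices thus differ in exactly one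
  position, so cliques live in a single coordinate and have at most \<open>k\<close> elements. Vertices with the
  same levels are independent, which gives \<open>k ^ d\<close> colour classes of equal size. They are maximum
  independent sets: if an antichain on one cycle occupies \<open>n x\<close> levels over position \<open>x\<close>, then the sum
  of the \<open>n x ^ d\<close> is at most the length of the cycle, because returning to a different level after
  using several levels at one position forces a long empty gap; the arithmetic-geometric mean
  inequality combines these bounds over the \<open>d\<close> coordinates.
\<close>

section \<open>Colourings by maximum independent sets\<close>

lemma finite_independent_sets: "finite V \<Longrightarrow> finite (independent_sets V E)"
  unfolding independent_sets_def by (rule finite_subset[of _ "Pow V"]) auto

lemma fractional_coloring_of_proper_coloring:
  assumes "finite V" and c: "proper_coloring V E n c"
  shows "\<exists>w. fractional_coloring V E w \<and> real n = (\<Sum>I \<in> independent_sets V E. w I)"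
proof -
  define f where "f j = {v \<in> V. c v = j}" for j
  define w where "w I = real (card {j \<in> {..<n}. f j = I})" for I
  have fin: "finite (independent_sets V E)"
    using assms by (simp add: finite_independent_sets)
  have f_in: "f j \<in> independent_sets V E" for j
    using c unfolding f_def independent_sets_def indep_def proper_coloring_def by fastforce
  have "(\<Sum>I \<in> independent_sets V E. w I)
      = (\<Sum>I \<in> independent_sets V E. \<Sum>j \<in> {j \<in> {..<n}. f j = I}. 1)"
    by (simp add: w_def)
  also have "\<dots> = (\<Sum>j<n. 1)"
    by (rule sum.group) (use fin f_in in auto)
  finally have total: "real n = (\<Sum>I \<in> independent_sets V E. w I)" by simp
  have "1 \<le> (\<Sum>I \<in> {I \<in> independent_sets V E. v \<in> I}. w I)" if "v \<in> V" for v
  proof -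
    have "c v \<in> {j \<in> {..<n}. f j = f (c v)}"
      using c that by (auto simp: proper_coloring_def)
    then have "{j \<in> {..<n}. f j = f (c v)} \<noteq> {}" by blast
    then have "card {j \<in> {..<n}. f j = f (c v)} > 0"
      by (simp only: card_gt_0_iff) simp
    then have "1 \<le> w (f (c v))"
      unfolding w_def by linarith
    also have "\<dots> \<le> (\<Sum>I \<in> {I \<in> independent_sets V E. v \<in> I}. w I)"
      by (rule member_le_sum) (use fin f_in that in \<open>auto simp: w_def f_def\<close>)
    finally show ?thesis .
  qed
  then have "fractional_coloring V E w"
    unfolding fractional_coloring_def by (simp add: w_def)
  with total show ?thesis by blast
qed

text \<open>Double counting of the incidences between vertices and independent sets, weighted by
  \<open>w\<close>.\<close>

lemma card_le_fractional_weight: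
  assumes "finite V" and w: "fractional_coloring V E w"
    and \<alpha>: "\<And>I. I \<in> independent_sets V E \<Longrightarrow> card I \<le> \<alpha>"
  shows "real (card V) \<le> real \<alpha> * (\<Sum>I \<in> independent_sets V E. w I)"
proof -
  let ?I = "independent_sets V E"
  have fin: "finite ?I" using assms by (simp add: finite_independent_sets)
  have "real (card V) = (\<Sum>v\<in>V. 1)" by simp
  also have "\<dots> \<le> (\<Sum>v\<in>V. \<Sum>I \<in> {I \<in> ?I. v \<in> I}. w I)"
    by (rule sum_mono) (use w in \<open>auto simp: fractional_coloring_def\<close>)
  also have "\<dots> = (\<Sum>I\<in>?I. \<Sum>v \<in> {v \<in> V. v \<in> I}. w I)"
    by (rule sum.swap_restrict) (use assms fin in auto)
  also have "\<dots> = (\<Sum>I\<in>?I. real (card I) * w I)"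
  proof (rule sum.cong[OF refl])
    fix I assume "I \<in> ?I"
    then have "{v \<in> V. v \<in> I} = I" by (auto simp: independent_sets_def)
    then show "(\<Sum>v \<in> {v \<in> V. v \<in> I}. w I) = real (card I) * w I" by simp
  qed
  also have "\<dots> \<le> (\<Sum>I\<in>?I. real \<alpha> * w I)"
    by (rule sum_mono) (use w \<alpha> in \<open>auto simp: fractional_coloring_def intro!: mult_right_mono\<close>)
  finally show ?thesis by (simp add: sum_distrib_left)
qed

text \<open>The colouring bounds both numbers by \<open>n\<close> from above. Double counting gives
  every fractional colouring weight at least \<open>n\<close>, and a proper colouring with
  \<open>m\<close> colours yields a fractional one of weight \<open>m\<close>.\<close>

lemma chromatic_numbers_eq:
  assumes "finite V" and c: "proper_coloring V E n c" and "card V = n * \<alpha>" and "\<alpha> > 0"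
    and \<alpha>: "\<And>I. I \<in> independent_sets V E \<Longrightarrow> card I \<le> \<alpha>"
  shows "fractional_chromatic_number V E = real n" and "chromatic_number V E = n"
proof -
  have lower: "real n \<le> (\<Sum>I \<in> independent_sets V E. w I)" if "fractional_coloring V E w" for w
    using card_le_fractional_weight[OF \<open>finite V\<close> that \<alpha>] assms by simp
  show "fractional_chromatic_number V E = real n"
    unfolding fractional_chromatic_number_def
    by (rule Least_equality)
      (use fractional_coloring_of_proper_coloring[OF \<open>finite V\<close> c] lower in auto)
  have "n \<le> m" if "proper_coloring V E m c'" for m c'
    using fractional_coloring_of_proper_coloring[OF \<open>finite V\<close> that] lower by fastforce
  then show "chromatic_number V E = n"
    unfolding chromatic_number_def by (intro Least_equality) (use c in auto)
qed

text \<open>The inequality of arithmetic and geometric means for the powers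
  \<open>f i ^ card S\<close>, freed of roots and division.\<close>

lemma card_mult_prod_le_sum_power:
  fixes f :: "'a \<Rightarrow> nat"
  assumes "finite S"
  shows "card S * (\<Prod>i\<in>S. f i) \<le> (\<Sum>i\<in>S. f i ^ card S)"
proof (cases "S = {}")
  case False
  then have S: "card S > 0" using assms by (simp add: card_gt_0_iff)
  have pow: "(x ^ card S) powr (1 / card S) = x" if "x \<ge> 0" for x :: real
    using that S by (cases "x = 0") (auto simp: powr_powr simp flip: powr_realpow)
  have "(\<Prod>i\<in>S. real (f i)) = ((\<Prod>i\<in>S. real (f i)) ^ card S) powr (1 / card S)"
    by (rule pow[symmetric]) (simp add: prod_nonneg)
  also have "\<dots> = (\<Prod>i\<in>S. real (f i) ^ card S) powr (1 / card S)"
    by (simp add: prod_power_distrib)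
  also have "\<dots> \<le> (\<Sum>i\<in>S. real (f i) ^ card S / card S)"
    using arith_geom_mean[OF assms False, of "\<lambda>i. real (f i) ^ card S"] by simp
  also have "\<dots> = (\<Sum>i\<in>S. real (f i) ^ card S) / card S"
    by (simp add: sum_divide_distrib)
  finally have "real (card S) * (\<Prod>i\<in>S. real (f i)) \<le> (\<Sum>i\<in>S. real (f i) ^ card S)"
    using S by (simp add: field_simps)
  then have "real (card S * (\<Prod>i\<in>S. f i)) \<le> real (\<Sum>i\<in>S. f i ^ card S)"
    by simp
  then show ?thesis by (simp only: of_nat_le_iff)
qed simp

section \<open>A cyclic order with \<open>k\<close> levels\<close>

locale cyclic_levels =
  fixes k d :: nat
  assumes k_pos: "k > 0" and d_pos: "d > 0"
begin

definition width :: nat where "width = k ^ d * k"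

text \<open>Displacements between levels below \<open>k\<close> are at most
  \<open>k * width\<close>; the extra position keeps them from closing a full turn.\<close>

definition period :: nat where "period = k * width + 1"

text \<open>The lower element lies ahead on the cycle: its position is reached from that of the
  higher one by going forward \<open>t\<close> steps.\<close>

definition prec :: "nat \<times> nat \<Rightarrow> nat \<times> nat \<Rightarrow> bool" where
  "prec p q \<longleftrightarrow> fst p < fst q \<and>
     (\<exists>t. 1 \<le> t \<and> t \<le> (fst q - fst p) * width \<and> snd p = (snd q + t) mod period)"

lemma width_pos: "width > 0"
  using k_pos by (simp add: width_def)

lemma period_pos: "period > 0"
  by (simp add: period_def)

text \<open>The displacements add up, and so do their bounds, since these are proportional to the
  level differences.\<close>

lemma prec_trans:
  assumes "prec p q" and "prec q r"
  shows "prec p r"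
proof -
  obtain s t where s: "1 \<le> s" "s \<le> (fst q - fst p) * width" "snd p = (snd q + s) mod period"
    and t: "1 \<le> t" "t \<le> (fst r - fst q) * width" "snd q = (snd r + t) mod period"
    using assms by (auto simp: prec_def)
  have lev: "fst p < fst q" "fst q < fst r" using assms by (auto simp: prec_def)
  have "(fst r - fst p) = (fst r - fst q) + (fst q - fst p)" using lev by simp
  then have "t + s \<le> (fst r - fst p) * width"
    using s(2) t(2) by (simp add: add_mult_distrib)
  moreover have "snd p = (snd r + (t + s)) mod period"
    using s(3) t(3) by (simp add: mod_add_left_eq add.assoc)
  ultimately show ?thesis
    unfolding prec_def using lev t(1) by (intro conjI exI[of _ "t + s"]) auto
qed

lemma prec_snd_neq:
  assumes "prec p q" and "fst q < k" and "snd q < period"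
  shows "snd p \<noteq> snd q"
proof
  assume eq: "snd p = snd q"
  obtain t where t: "1 \<le> t" "t \<le> (fst q - fst p) * width" "snd p = (snd q + t) mod period"
    using assms by (auto simp: prec_def)
  have "t \<le> k * width"
    using t(2) assms(2) by (meson diff_le_self le_trans less_imp_le mult_le_mono1)
  then have "t < period" by (simp add: period_def)
  show False
  proof (cases "snd q + t < period")
    case True
    then show False using eq t by simp
  next
    case False
    then have "(snd q + t) mod period = snd q + t - period"
      using \<open>t < period\<close> assms(3) by (simp add: mod_if)
    then show False using eq t \<open>t < period\<close> False by linarith
  qed
qed

section \<open>The potential of an antichain on the cycle\<close>

text \<open>
  Moving one position ahead lowers the potential by at most one, and going past a position where
  an antichain occupies several levels raises it by at least \<open>k ^ d\<close> per additional level. The cap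
  \<open>k ^ d * k\<close> equals \<open>width\<close>: at larger distances, elements of the antichain on adjacent levels do
  not constrain each other.
\<close>
definition potential :: "(nat \<times> nat) set \<Rightarrow> nat \<Rightarrow> nat" where
  "potential A x = Inf (insert (k ^ d * k) {k ^ d * a + t | a t. (a, (x + t) mod period) \<in> A})"

lemma potential_le_cap: "potential A x \<le> k ^ d * k"
  unfolding potential_def by (rule cInf_lower) auto

lemma potential_le: "(a, (x + t) mod period) \<in> A \<Longrightarrow> potential A x \<le> k ^ d * a + t"
  unfolding potential_def by (rule cInf_lower) auto

lemma potential_cases:
  obtains "potential A x = k ^ d * k"
  | a t where "(a, (x + t) mod period) \<in> A" "potential A x = k ^ d * a + t"
proof -
  have "potential A x \<in> insert (k ^ d * k) {k ^ d * a + t | a t. (a, (x + t) mod period) \<in> A}"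
    unfolding potential_def by (rule Inf_nat_def1) simp
  then show thesis using that by blast
qed

text \<open>With no level over \<open>x\<close>, an element at distance \<open>t\<close> from the
  next position is at distance \<open>Suc t\<close> from \<open>x\<close>. Otherwise the lowest
  level over \<open>x\<close> bounds the potential there from above, and the highest one bounds the
  next potential from below.\<close>

lemma potential_step:
  assumes A: "A \<subseteq> {..<k} \<times> {..<period}"
    and anti: "\<And>p q. p \<in> A \<Longrightarrow> q \<in> A \<Longrightarrow> \<not> prec p q"
    and x: "x < period"
  shows "card {a. (a, x) \<in> A} ^ d + potential A x \<le> potential A (Suc x mod period) + 1"
proof -
  define F where "F = {a. (a, x) \<in> A}"
  have F: "F \<subseteq> {..<k}" using A by (auto simp: F_def)
  then have finF: "finite F" using finite_subset by blast
  have shift: "(Suc x mod period + t) mod period = (x + Suc t) mod period" for t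
    by (simp add: mod_add_left_eq)
  show ?thesis
  proof (cases "F = {}")
    case True
    have "potential A x \<le> potential A (Suc x mod period) + 1"
    proof (cases rule: potential_cases[of A "Suc x mod period"])
      case 1
      then show ?thesis using potential_le_cap[of A x] by simp
    next
      case (2 a t)
      then show ?thesis using potential_le[of a x "Suc t" A] by (simp add: shift)
    qed
    then show ?thesis using True d_pos unfolding F_def by (simp add: zero_power)
  next
    case False
    define b where "b = Min F"
    define T where "T = Max F"
    have bT: "b \<in> F" "T \<in> F" "b \<le> T"
      using False finF by (auto simp: b_def T_def)
    have low: "potential A x \<le> k ^ d * b"
      using potential_le[of b x 0 A] bT x by (simp add: F_def)
    have high: "k ^ d * T \<le> potential A (Suc x mod period)"
    proof (cases rule: potential_cases[of A "Suc x mod period"])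
      case 1
      then show ?thesis using bT F by auto
    next
      case (2 a t)
      show ?thesis
      proof (cases "Suc t \<le> width")
        case True
        \<comment> \<open>An element of lower level at most \<open>width\<close> ahead would precede
          \<open>(T, x)\<close>.\<close>
        have "\<not> prec (a, (x + Suc t) mod period) (T, x)"
          using anti 2(1) bT by (simp add: shift F_def)
        moreover have "Suc t \<le> (T - a) * width" if "a < T"
        proof -
          have "1 * width \<le> (T - a) * width" using that by (intro mult_le_mono1) simp
          then show ?thesis using True by linarith
        qed
        ultimately have "T \<le> a"
          unfolding prec_def fst_conv snd_conv by (metis le_add1 not_le plus_1_eq_Suc)
        then show ?thesis using 2 by (simp add: trans_le_add1)
      next
        case False
        \<comment> \<open>From distance \<open>width\<close> on, the term \<open>t\<close> alone is
          at least the cap.\<close>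
        then have "k ^ d * k \<le> t" by (simp add: width_def)
        moreover have "k ^ d * T \<le> k ^ d * k" using bT F by auto
        ultimately show ?thesis using 2 by linarith
      qed
    qed
    \<comment> \<open>A single level contributes \<open>1 ^ d\<close>, paid for by the
      \<open>+ 1\<close>. Several levels give \<open>b < T\<close>, and one level's worth
      \<open>k ^ d\<close> already covers \<open>card F ^ d\<close>.\<close>
    have "card F ^ d + k ^ d * b \<le> k ^ d * T + 1"
    proof (cases "b = T")
      case True
      have "y = b" if "y \<in> F" for y
        using True Min_le[OF finF that] Max_ge[OF finF that] unfolding b_def T_def by simp
      then have "F = {b}" using bT by blast
      then show ?thesis using True by simp
    next
      case False
      then have "Suc b \<le> T" using bT by simp
      then have "k ^ d * Suc b \<le> k ^ d * T" by (rule mult_le_mono2)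
      moreover have "card F ^ d \<le> k ^ d"
        using card_mono[OF _ F] by (intro power_mono) auto
      ultimately show ?thesis by simp
    qed
    then show ?thesis using low high by (simp add: F_def)
  qed
qed

end

section \<open>The product graph\<close>

text \<open>Vertices are abstract and \<open>h\<close> assigns their coordinates, so that the graph
  can be placed on the natural numbers.\<close>

locale product_graph = cyclic_levels +
  fixes V :: "'a set" and h :: "'a \<Rightarrow> nat \<Rightarrow> nat \<times> nat"
  assumes h_bij: "bij_betw h V ({..<d} \<rightarrow>\<^sub>E {..<k} \<times> {..<period})"
begin

abbreviation lev :: "'a \<Rightarrow> nat \<Rightarrow> nat" where "lev x i \<equiv> fst (h x i)"

abbreviation pos :: "'a \<Rightarrow> nat \<Rightarrow> nat" where "pos x i \<equiv> snd (h x i)"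

text \<open>Levels outside coordinate \<open>i\<close> are left free, so the members of an
  independent set on a whole line in direction \<open>i\<close> project to a single
  antichain.\<close>

definition less_in :: "nat \<Rightarrow> 'a \<Rightarrow> 'a \<Rightarrow> bool" where
  "less_in i x y \<longleftrightarrow> x \<in> V \<and> y \<in> V \<and> (\<forall>j<d. j \<noteq> i \<longrightarrow> pos x j = pos y j) \<and> prec (h x i) (h y i)"

definition edges_in :: "nat \<Rightarrow> 'a set set" where
  "edges_in i = {{x, y} | x y. less_in i x y}"

definition edges :: "'a set set" where
  "edges = (\<Union>i<d. edges_in i)"

lemma finite_V: "finite V"
  using bij_betw_finite[OF h_bij] by (simp add: finite_PiE)

lemma card_V: "card V = k ^ d * period ^ d"
  using bij_betw_same_card[OF h_bij] by (simp add: card_PiE power_mult_distrib)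

lemma h_mem: "x \<in> V \<Longrightarrow> h x \<in> {..<d} \<rightarrow>\<^sub>E {..<k} \<times> {..<period}"
  using h_bij by (auto simp: bij_betw_def)

lemma lev_less: "x \<in> V \<Longrightarrow> i < d \<Longrightarrow> lev x i < k"
  and pos_less: "x \<in> V \<Longrightarrow> i < d \<Longrightarrow> pos x i < period"
  using PiE_mem[OF h_mem, of x i] by auto

lemma h_eqI:
  assumes "x \<in> V" "y \<in> V" "\<And>i. i < d \<Longrightarrow> lev x i = lev y i" "\<And>i. i < d \<Longrightarrow> pos x i = pos y i"
  shows "x = y"
proof -
  have "h x = h y"
    by (rule PiE_ext[OF h_mem h_mem]) (use assms in \<open>auto intro: prod_eqI\<close>)
  then show ?thesis using h_bij assms by (auto simp: bij_betw_def dest: inj_onD)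
qed

lemma h_surj:
  assumes "\<And>i. i < d \<Longrightarrow> f i < k" "\<And>i. i < d \<Longrightarrow> g i < period"
  obtains x where "x \<in> V" "\<And>i. i < d \<Longrightarrow> lev x i = f i" "\<And>i. i < d \<Longrightarrow> pos x i = g i"
proof -
  have "(\<lambda>i\<in>{..<d}. (f i, g i)) \<in> {..<d} \<rightarrow>\<^sub>E {..<k} \<times> {..<period}"
    using assms by auto
  then obtain x where "x \<in> V" "h x = (\<lambda>i\<in>{..<d}. (f i, g i))"
    using bij_betw_imp_surj_on[OF h_bij] by (metis imageE)
  then show thesis by (intro that[of x]) simp_all
qed

lemma less_in_lev: "less_in i x y \<Longrightarrow> lev x i < lev y i"
  by (auto simp: less_in_def prec_def)

text \<open>A displacement is nonzero and shorter than a full turn, so the one differing position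
  identifies the order that an edge comes from.\<close>

lemma less_in_pos: "less_in i x y \<Longrightarrow> i < d \<Longrightarrow> {j. j < d \<and> pos x j \<noteq> pos y j} = {i}"
  using prec_snd_neq[of "h x i" "h y i"] lev_less pos_less unfolding less_in_def by auto

lemma less_in_trans: "less_in i x y \<Longrightarrow> less_in i y z \<Longrightarrow> less_in i x z"
  unfolding less_in_def by (auto intro: prec_trans)

lemma edgeE:
  assumes "{x, y} \<in> edges"
  obtains i where "i < d" "less_in i x y \<or> less_in i y x"
  using assms unfolding edges_def edges_in_def by (auto simp: doubleton_eq_iff)

lemma edgeI: "i < d \<Longrightarrow> less_in i x y \<Longrightarrow> {x, y} \<in> edges"
  unfolding edges_def edges_in_def by blast

lemma edge_cases:
  assumes "{x, y} \<in> edges"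
  obtains i where "i < d" "{j. j < d \<and> pos x j \<noteq> pos y j} = {i}" "lev x i \<noteq> lev y i"
proof -
  obtain i where i: "i < d" "less_in i x y \<or> less_in i y x" using assms by (rule edgeE)
  from i(2) show thesis
  proof
    assume "less_in i x y"
    then show thesis
      using that[OF i(1) less_in_pos[OF _ i(1)]] less_in_lev by (metis less_irrefl)
  next
    assume yx: "less_in i y x"
    have "{j. j < d \<and> pos x j \<noteq> pos y j} = {j. j < d \<and> pos y j \<noteq> pos x j}" by metis
    also have "\<dots> = {i}" using yx i(1) by (rule less_in_pos)
    finally show thesis using that i(1) less_in_lev[OF yx] by (metis less_irrefl)
  qed
qed

section \<open>The graph as a union of comparability graphs\<close>

lemma simple_graph_edges: "simple_graph V edges"
  unfolding simple_graph_def
proof (intro conjI subsetI finite_V)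
  fix e assume "e \<in> edges"
  then obtain i x y where "e = {x, y}" "less_in i x y"
    unfolding edges_def edges_in_def by blast
  moreover from this have "x \<noteq> y" using less_in_lev by fastforce
  ultimately show "e \<in> nsets V 2" by (auto simp: less_in_def)
qed

lemma comparability_graph_edges_in: "comparability_graph V (edges_in i)"
proof -
  define r where "r = {(x, y). x \<in> V \<and> y \<in> V \<and> (x = y \<or> less_in i x y)}"
  have irrefl: "\<not> less_in i x x" for x using less_in_lev by blast
  have "partial_order_on V r"
    unfolding partial_order_on_def preorder_on_def
  proof (intro conjI)
    show "r \<subseteq> V \<times> V" "refl_on V r" by (auto simp: r_def refl_on_def)
    show "trans r" by (auto simp: r_def trans_def intro: less_in_trans)
    show "antisym r"
      using irrefl by (auto simp: r_def antisym_def dest: less_in_trans)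
  qed
  moreover have "edges_in i =
      {{x, y} | x y. x \<in> V \<and> y \<in> V \<and> x \<noteq> y \<and> ((x, y) \<in> r \<or> (y, x) \<in> r)}" (is "_ = ?R")
  proof (intro subset_antisym subsetI)
    fix e assume "e \<in> edges_in i"
    then obtain x y where "e = {x, y}" "less_in i x y" by (auto simp: edges_in_def)
    then show "e \<in> ?R" using irrefl unfolding r_def less_in_def by blast
  next
    fix e assume "e \<in> ?R"
    then obtain x y where "e = {x, y}" "less_in i x y \<or> less_in i y x"
      unfolding r_def by blast
    then show "e \<in> edges_in i" unfolding edges_in_def by (auto simp: insert_commute)
  qed
  ultimately show ?thesis
    unfolding comparability_graph_def using finite_V by blast
qed

lemma union_of_comparability_graphs_edges: "union_of_comparability_graphs d V edges"
  unfolding union_of_comparability_graphs_def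
  by (rule exI[of _ "\<lambda>_. V"], rule exI[of _ edges_in])
    (use d_pos comparability_graph_edges_in in \<open>auto simp: edges_def\<close>)

section \<open>The clique number\<close>

text \<open>
  Adjacent vertices differ in exactly one position, so all edges of a triangle, hence of a clique,
  come from the same coordinate.
\<close>
lemma card_clique_le:
  assumes K: "K \<subseteq> V" "clique K edges"
  shows "card K \<le> k"
proof (cases "\<exists>x\<in>K. \<exists>y\<in>K. x \<noteq> y")
  case False
  then have "card K \<le> 1"
    by (metis card_le_Suc0_iff_eq One_nat_def finite_subset[OF K(1) finite_V])
  then show ?thesis using k_pos by simp
next
  case True
  then obtain x y where xy: "x \<in> K" "y \<in> K" "x \<noteq> y" by blast
  define D where "D u v = {j. j < d \<and> pos u j \<noteq> pos v j}" for u v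
  have D_comm: "D u v = D v u" for u v by (auto simp: D_def)
  have D_tri: "D u w \<subseteq> D u v \<union> D v w" for u v w by (auto simp: D_def)
  have D: "\<exists>i<d. D u v = {i} \<and> lev u i \<noteq> lev v i" if "u \<in> K" "v \<in> K" "u \<noteq> v" for u v
  proof -
    have "{u, v} \<in> edges" using K that by (auto simp: clique_def)
    then show ?thesis unfolding D_def by (rule edge_cases) auto
  qed
  obtain i where i: "i < d" "D x y = {i}" using D xy by blast
  have Dx: "D x z \<subseteq> {i}" if zK: "z \<in> K" for z
  proof (cases "z = x \<or> z = y")
    case True
    then show ?thesis using i by (auto simp: D_def)
  next
    case False
    then obtain p q where pq: "D x z = {p}" "D y z = {q}"
      using D[OF xy(1) zK] D[OF xy(2) zK] by auto
    \<comment> \<open>If \<open>p\<close> differed from \<open>i\<close>, the two triangle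
      inclusions would force both \<open>i = q\<close> and \<open>p = q\<close>.\<close>
    then show ?thesis
      using i D_tri[of x y z] D_tri[of x z y] D_comm[of y z] by auto
  qed
  have "inj_on (\<lambda>z. lev z i) K"
  proof (rule inj_onI, rule ccontr)
    fix z w assume zw: "z \<in> K" "w \<in> K" "lev z i = lev w i" "z \<noteq> w"
    then obtain l where "D z w = {l}" "lev z l \<noteq> lev w l" using D by blast
    moreover have "D z w \<subseteq> {i}"
      using D_tri[of z w x] Dx[OF zw(1)] Dx[OF zw(2)] D_comm[of z x] by blast
    ultimately show False using zw by auto
  qed
  moreover have "(\<lambda>z. lev z i) ` K \<subseteq> {..<k}" using K i lev_less by auto
  ultimately have "card K \<le> card {..<k}" by (intro card_inj_on_le) auto
  then show ?thesis by simp
qed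

text \<open>In coordinate 0, level \<open>a\<close> is put at position \<open>k - a\<close>: each
  rise by one level moves back one position, which is within the bound because \<open>width\<close>
  is positive.\<close>

lemma ex_clique: "\<exists>K. K \<subseteq> V \<and> clique K edges \<and> card K = k"
proof -
  have kp: "k < period"
  proof -
    have "k * 1 \<le> k * width" using width_pos by (intro mult_le_mono2) linarith
    then show ?thesis unfolding period_def by linarith
  qed
  define Q where "Q a x \<longleftrightarrow> x \<in> V \<and>
      (\<forall>i<d. lev x i = (if i = 0 then a else 0) \<and> pos x i = (if i = 0 then k - a else 0))" for a x
  have "\<exists>x. Q a x" if "a < k" for a
  proof -
    obtain x where "x \<in> V" "\<And>i. i < d \<Longrightarrow> lev x i = (if i = 0 then a else 0)"
      "\<And>i. i < d \<Longrightarrow> pos x i = (if i = 0 then k - a else 0)"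
      by (rule h_surj[of "\<lambda>i. if i = 0 then a else 0" "\<lambda>i. if i = 0 then k - a else 0"])
        (use \<open>a < k\<close> k_pos kp period_pos in auto)
    then show ?thesis unfolding Q_def by blast
  qed
  then obtain v where "\<And>a. a < k \<Longrightarrow> Q a (v a)" by metis
  then have v: "\<And>a. a < k \<Longrightarrow> v a \<in> V"
    "\<And>a i. a < k \<Longrightarrow> i < d \<Longrightarrow> lev (v a) i = (if i = 0 then a else 0)"
    "\<And>a i. a < k \<Longrightarrow> i < d \<Longrightarrow> pos (v a) i = (if i = 0 then k - a else 0)"
    by (auto simp: Q_def)
  have less: "less_in 0 (v a) (v b)" if "a < b" "b < k" for a b
  proof -
    have "b - a \<le> (b - a) * width" using width_pos by simp
    moreover have "k - a = (k - b + (b - a)) mod period" using that kp by simp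
    ultimately have "\<exists>t. 1 \<le> t \<and> t \<le> (b - a) * width \<and> k - a = (k - b + t) mod period"
      using that by (intro exI[of _ "b - a"]) auto
    then have "prec (h (v a) 0) (h (v b) 0)"
      using that v d_pos by (simp add: prec_def)
    then show ?thesis using that v unfolding less_in_def by simp
  qed
  have "inj_on v {..<k}"
    by (rule inj_on_inverseI[of _ "\<lambda>x. lev x 0"]) (use v(2)[OF _ d_pos] in simp)
  then have "card (v ` {..<k}) = k" by (simp add: card_image)
  moreover have "clique (v ` {..<k}) edges"
    unfolding clique_def
  proof (intro ballI impI)
    fix x y assume "x \<in> v ` {..<k}" "y \<in> v ` {..<k}" "x \<noteq> y"
    then obtain a b where ab: "a < k" "b < k" "x = v a" "y = v b" "a \<noteq> b" by auto
    have "{v a, v b} \<in> edges"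
    proof (cases "a < b")
      case True
      then show ?thesis using edgeI[OF d_pos less] ab(2) by blast
    next
      case False
      then have "b < a" using ab(5) by simp
      then have "{v b, v a} \<in> edges" using edgeI[OF d_pos less] ab(1) by blast
      then show ?thesis by (simp only: insert_commute)
    qed
    then show "{x, y} \<in> edges" by (simp only: ab)
  qed
  moreover have "v ` {..<k} \<subseteq> V" using v(1) by (intro image_subsetI) simp
  ultimately show ?thesis by (intro exI[of _ "v ` {..<k}"] conjI)
qed

lemma clique_number_edges: "clique_number V edges = k"
  unfolding clique_number_def
proof (rule Max_eqI)
  have "{card K | K. K \<subseteq> V \<and> clique K edges} \<subseteq> {..k}" using card_clique_le by auto
  then show "finite {card K | K. K \<subseteq> V \<and> clique K edges}" by (rule finite_subset) simp
  show "m \<le> k" if "m \<in> {card K | K. K \<subseteq> V \<and> clique K edges}" for m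
    using that card_clique_le by blast
  show "k \<in> {card K | K. K \<subseteq> V \<and> clique K edges}"
    using ex_clique by blast
qed

section \<open>The independence number\<close>

text \<open>
  On each line parallel to a coordinate axis, the independent set projects to an antichain
  \<open>A i p\<close>, and the number of its vertices over a point \<open>p\<close> is at most the product of the \<open>n i p\<close>.
  The potential telescopes along the cyclic shift \<open>\<sigma>\<close>.
\<close>
lemma card_independent_le:
  assumes S: "S \<subseteq> V" "indep S edges"
  shows "card S \<le> period ^ d"
proof -
  let ?P = "{..<d} \<rightarrow>\<^sub>E {..<period}"
  define A where "A i p = (\<lambda>v. h v i) ` {v \<in> S. \<forall>j<d. j \<noteq> i \<longrightarrow> pos v j = p j}"
    for i and p :: "nat \<Rightarrow> nat"
  define n where "n i p = card {a. (a, p i) \<in> A i p}" for i p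
  have finP: "finite ?P" by (simp add: finite_PiE)
  have cardP: "card ?P = period ^ d" by (simp add: card_PiE)
  have A_sub: "A i p \<subseteq> {..<k} \<times> {..<period}" if "i < d" for i p
    using that S lev_less pos_less unfolding A_def
    by (intro image_subsetI) (auto simp: mem_Times_iff)
  have finA: "finite {a. (a, x) \<in> A i p}" if "i < d" for i p x
    by (rule finite_subset[of _ "{..<k}"]) (use A_sub[OF that] in auto)
  have line: "(\<Sum>p\<in>?P. n i p ^ d) \<le> period ^ d" if i: "i < d" for i
  proof -
    define \<sigma> where "\<sigma> p = p(i := Suc (p i) mod period)" for p :: "nat \<Rightarrow> nat"
    define u where "u p = potential (A i p) (p i)" for p
    \<comment> \<open>\<open>A i p\<close> does not depend on \<open>p i\<close>, so the antichain
      stays fixed while its potential is read along the cycle.\<close>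
    have A_\<sigma>: "A i (\<sigma> p) = A i p" for p
      unfolding A_def \<sigma>_def by auto
    have "n i p ^ d + u p \<le> u (\<sigma> p) + 1" if p: "p \<in> ?P" for p
    proof -
      have "\<not> prec a b" if ab: "a \<in> A i p" "b \<in> A i p" for a b
      proof
        assume prec: "prec a b"
        obtain v w where v: "v \<in> S" "a = h v i" "\<forall>j<d. j \<noteq> i \<longrightarrow> pos v j = p j"
          and w: "w \<in> S" "b = h w i" "\<forall>j<d. j \<noteq> i \<longrightarrow> pos w j = p j"
          using ab unfolding A_def by blast
        then have less: "less_in i v w" using prec S unfolding less_in_def by auto
        then have "v \<noteq> w" using less_in_lev by blast
        then show False
          using edgeI[OF i less] v(1) w(1) S(2) unfolding indep_def by blast
      qed
      from potential_step[OF A_sub[OF i] this, of p "p i"] show ?thesis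
        using p i unfolding n_def u_def A_\<sigma> by (auto simp: \<sigma>_def)
    qed
    then have "(\<Sum>p\<in>?P. n i p ^ d) + (\<Sum>p\<in>?P. u p) \<le> (\<Sum>p\<in>?P. u (\<sigma> p)) + card ?P"
      using sum_mono[of ?P "\<lambda>p. n i p ^ d + u p" "\<lambda>p. u (\<sigma> p) + 1"]
      by (simp add: sum.distrib sum_Suc)
    moreover have "bij_betw \<sigma> ?P ?P"
    proof -
      have "inj_on \<sigma> ?P"
      proof (rule inj_onI)
        fix p q assume pq: "p \<in> ?P" "q \<in> ?P" "\<sigma> p = \<sigma> q"
        have "Suc (p i) mod period = Suc (q i) mod period"
          using fun_cong[OF pq(3), of i] by (simp add: \<sigma>_def)
        moreover have "p i < period" "q i < period" using pq i by auto
        ultimately have "p i = q i" by (auto simp: mod_Suc split: if_splits)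
        moreover have "p = (\<sigma> p)(i := p i)" "q = (\<sigma> q)(i := q i)"
          by (simp_all add: \<sigma>_def)
        ultimately show "p = q" using pq(3) by simp
      qed
      moreover have "\<sigma> ` ?P \<subseteq> ?P"
        using i period_pos by (intro image_subsetI) (simp add: \<sigma>_def PiE_iff extensional_def)
      ultimately show ?thesis
        using endo_inj_surj[OF finP] unfolding bij_betw_def by blast
    qed
    then have "(\<Sum>p\<in>?P. u (\<sigma> p)) = (\<Sum>p\<in>?P. u p)" by (rule sum.reindex_bij_betw)
    ultimately show ?thesis using cardP by simp
  qed
  define \<pi> where "\<pi> v = (\<lambda>i\<in>{..<d}. pos v i)" for v
  have finS: "finite S" using S finite_V finite_subset by blast
  have pos_eq: "pos v i = \<pi> v i" if "i < d" for v i
    using that by (simp add: \<pi>_def)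
  have \<pi>: "\<pi> ` S \<subseteq> ?P"
    using S pos_less unfolding \<pi>_def by (intro image_subsetI) (auto simp: restrict_PiE_iff)
  \<comment> \<open>Over a fixed point the levels determine the vertex, and its level in coordinate
    \<open>i\<close> is one of the \<open>n i p\<close> levels of the antichain.\<close>
  have fibre: "card {v \<in> S. \<pi> v = p} \<le> (\<Prod>i<d. n i p)" for p
  proof -
    let ?l = "\<lambda>v. \<lambda>i\<in>{..<d}. lev v i"
    let ?T = "\<Pi>\<^sub>E i\<in>{..<d}. {a. (a, p i) \<in> A i p}"
    have "inj_on ?l {v \<in> S. \<pi> v = p}"
    proof (rule inj_onI)
      fix v w assume vw: "v \<in> {v \<in> S. \<pi> v = p}" "w \<in> {v \<in> S. \<pi> v = p}" "?l v = ?l w"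
      then have "\<pi> v = \<pi> w" by simp
      then have "pos v i = pos w i" if "i < d" for i
        using that pos_eq by metis
      moreover have "lev v i = lev w i" if "i < d" for i
        using fun_cong[OF vw(3), of i] that by simp
      moreover have "v \<in> V" "w \<in> V" using vw S by auto
      ultimately show "v = w" by (intro h_eqI)
    qed
    moreover have "?l ` {v \<in> S. \<pi> v = p} \<subseteq> ?T"
    proof (rule image_subsetI)
      fix v assume v: "v \<in> {v \<in> S. \<pi> v = p}"
      have pos_v: "pos v i = p i" if "i < d" for i
        using v pos_eq[OF that, of v] by simp
      have "(lev v i, p i) \<in> A i p" if "i < d" for i
        unfolding A_def using v pos_v that by (intro image_eqI[of _ _ v]) (auto intro: prod_eqI)
      then show "?l v \<in> ?T" by (simp add: restrict_PiE_iff)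
    qed
    moreover have "finite ?T" using finA by (intro finite_PiE) auto
    ultimately have "card {v \<in> S. \<pi> v = p} \<le> card ?T"
      by (rule card_inj_on_le)
    then show ?thesis by (simp add: card_PiE n_def)
  qed
  \<comment> \<open>The factor \<open>d\<close> suits the inequality of means; the line bounds of
    all \<open>d\<close> coordinates then add up to \<open>d * period ^ d\<close>.\<close>
  have "d * card S = d * (\<Sum>p\<in>?P. card {v \<in> S. \<pi> v = p})"
    using sum.group[OF finS finP \<pi>, of "\<lambda>_. 1::nat"] by simp
  also have "\<dots> \<le> d * (\<Sum>p\<in>?P. \<Prod>i<d. n i p)"
    by (intro mult_le_mono2 sum_mono fibre)
  also have "\<dots> = (\<Sum>p\<in>?P. d * (\<Prod>i<d. n i p))" by (rule sum_distrib_left)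
  also have "\<dots> \<le> (\<Sum>p\<in>?P. \<Sum>i<d. n i p ^ d)"
    by (rule sum_mono) (use card_mult_prod_le_sum_power[of "{..<d}"] in simp)
  also have "\<dots> = (\<Sum>i<d. \<Sum>p\<in>?P. n i p ^ d)" by (rule sum.swap)
  also have "\<dots> \<le> (\<Sum>i<d. period ^ d)" by (rule sum_mono) (use line in simp)
  finally show ?thesis using d_pos by simp
qed

text \<open>An edge changes the level in the coordinate of its order.\<close>

lemma indep_of_equal_levels:
  assumes "\<And>x y i. x \<in> S \<Longrightarrow> y \<in> S \<Longrightarrow> i < d \<Longrightarrow> lev x i = lev y i"
  shows "indep S edges"
  unfolding indep_def
proof (intro ballI impI notI)
  fix x y assume "x \<in> S" "y \<in> S" "{x, y} \<in> edges"
  then show False using assms by (elim edge_cases) blast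
qed

lemma independence_number_edges: "independence_number V edges = period ^ d"
  unfolding independence_number_def
proof (rule Max_eqI)
  show "finite (card ` independent_sets V edges)"
    using finite_V by (simp add: finite_independent_sets)
  show "m \<le> period ^ d" if "m \<in> card ` independent_sets V edges" for m
    using that card_independent_le by (auto simp: independent_sets_def)
  \<comment> \<open>The bound is attained by the vertices of one fixed level vector, here zero: only
    their \<open>d\<close> positions vary.\<close>
  define S where "S = {v \<in> V. \<forall>i<d. lev v i = 0}"
  have S: "S \<in> independent_sets V edges"
    unfolding independent_sets_def by (auto simp: S_def intro: indep_of_equal_levels)
  have "bij_betw h S ({..<d} \<rightarrow>\<^sub>E {0} \<times> {..<period})"
    unfolding bij_betw_def
  proof (intro conjI subset_antisym subsetI)
    show "inj_on h S"
      using h_bij by (auto simp: bij_betw_def S_def intro: inj_on_subset)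
    show "f \<in> {..<d} \<rightarrow>\<^sub>E {0} \<times> {..<period}" if "f \<in> h ` S" for f
      using that by (auto simp: S_def mem_Times_iff pos_less PiE_iff dest: h_mem)
    show "f \<in> h ` S" if f: "f \<in> {..<d} \<rightarrow>\<^sub>E {0} \<times> {..<period}" for f
    proof -
      have "f \<in> {..<d} \<rightarrow>\<^sub>E {..<k} \<times> {..<period}" using f k_pos by (auto simp: PiE_iff mem_Times_iff)
      then obtain v where "v \<in> V" "h v = f"
        using bij_betw_imp_surj_on[OF h_bij] by (metis imageE)
      moreover have "fst (f i) = 0" if "i < d" for i
        using PiE_mem[OF f, of i] that by auto
      ultimately show ?thesis unfolding S_def by blast
    qed
  qed
  then have "card S = period ^ d"
    by (simp add: bij_betw_same_card card_PiE)
  then show "period ^ d \<in> card ` independent_sets V edges" using S by (metis imageI)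
qed

section \<open>The chromatic numbers\<close>

lemma ex_proper_coloring: "\<exists>c. proper_coloring V edges (k ^ d) c"
proof -
  let ?L = "{..<d} \<rightarrow>\<^sub>E {..<k}"
  have "card ?L = k ^ d" by (simp add: card_PiE)
  then obtain e where e: "bij_betw e ?L {..<k ^ d}"
    using ex_bij_betw_finite_nat[of ?L] by (auto simp: finite_PiE atLeast0LessThan)
  \<comment> \<open>The colour of a vertex is its level vector, numbered by \<open>e\<close>; every
    edge changes some entry of it.\<close>
  define l where "l v = (\<lambda>i\<in>{..<d}. lev v i)" for v
  have l: "l v \<in> ?L" if "v \<in> V" for v using that lev_less by (auto simp: l_def)
  have "proper_coloring V edges (k ^ d) (e \<circ> l)"
    unfolding proper_coloring_def
  proof (intro conjI ballI impI)
    show "(e \<circ> l) ` V \<subseteq> {..<k ^ d}" using e l by (auto simp: bij_betw_def)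
    fix x y assume xy: "x \<in> V" "y \<in> V" "{x, y} \<in> edges"
    obtain i where i: "i < d" "lev x i \<noteq> lev y i" using xy(3) by (rule edge_cases)
    then have "l x \<noteq> l y" by (auto simp: l_def dest: fun_cong[of _ _ i])
    then show "(e \<circ> l) x \<noteq> (e \<circ> l) y"
      using e l xy by (auto simp: bij_betw_def inj_on_eq_iff)
  qed
  then show ?thesis by blast
qed

lemma chromatic_numbers_edges:
  "fractional_chromatic_number V edges = real (k ^ d)" "chromatic_number V edges = k ^ d"
proof -
  obtain c where c: "proper_coloring V edges (k ^ d) c" using ex_proper_coloring by blast
  have \<alpha>: "card I \<le> period ^ d" if "I \<in> independent_sets V edges" for I
    using that card_independent_le by (auto simp: independent_sets_def)
  show "fractional_chromatic_number V edges = real (k ^ d)" "chromatic_number V edges = k ^ d"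
    using chromatic_numbers_eq[OF finite_V c card_V _ \<alpha>] period_pos by auto
qed

end

theorem theorem2:
  fixes k d :: nat
  assumes "k > 0" and "d > 0"
  shows "\<exists>(V :: nat set) E.
           simple_graph V E \<and>
           union_of_comparability_graphs d V E \<and>
           clique_number V E = k \<and>
           real (card V) / real (independence_number V E) = fractional_chromatic_number V E \<and>
           fractional_chromatic_number V E = real (chromatic_number V E) \<and>
           chromatic_number V E = k ^ d"
proof -
  interpret cyclic_levels k d using assms by unfold_locales
  \<comment> \<open>An initial segment of the naturals with one label per coordinate vector; any
    bijection may serve as \<open>h\<close>.\<close>
  define V where "V = {0..<card ({..<d} \<rightarrow>\<^sub>E {..<k} \<times> {..<period})}"
  have "finite ({..<d} \<rightarrow>\<^sub>E {..<k} \<times> {..<period})" by (intro finite_PiE) auto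
  then obtain h where "bij_betw h V ({..<d} \<rightarrow>\<^sub>E {..<k} \<times> {..<period})"
    unfolding V_def using ex_bij_betw_nat_finite by blast
  then interpret product_graph k d V h by unfold_locales
  have "real (card V) / real (independence_number V edges) = real (k ^ d)"
    using period_pos by (simp add: card_V independence_number_edges)
  then show ?thesis
    using simple_graph_edges union_of_comparability_graphs_edges clique_number_edges
      chromatic_numbers_edges by (intro exI[of _ V] exI[of _ edges]) simp
qed

end
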